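(* For every $n\ge1$ the projection $$P:\pi_0(\mathbb{A}_n)\to\mathrm{O}^{\pm}(n,n,\mathbb{Z}),\qquad (A,\eta)\mapsto A,$$ is an isomorphism of groups.
   Context: $\mathrm{U}(1)=\mathbb{R}/\mathbb{Z}$ is written additively. $[a,b]=a^{tr}Jb$ on $\mathbb{R}^{2n}$ with $J=\begin{pmatrix}0&0\\ E_n&0\end{pmatrix}$; $I=\begin{pmatrix}0&E_n\\ E_n&0\end{pmatrix}$; $\mathrm{O}^{\pm}(n,n,\mathbb{Z})=\{A\in\mathrm{GL}(2n,\mathbb{Z}):A^{tr}IA=\pm I\}$, and $\mathrm{iso}(A)\in\{\pm1\}$ is the sign with $A^{tr}IA=\mathrm{iso}(A)I$. **The strict 2-group $\mathbb{A}_n$.** Objects are pairs $(A,\eta)$ with $A\in\mathrm{O}^{\pm}(n,n,\mathbb{Z})$ and $\eta:\mathbb{R}^{2n}\times\mathbb{R}^{2n}\to\mathrm{U}(1)$ smooth such that for all $a,a',a''\in\mathbb{R}^{2n}$, $m,m'\in\mathbb{Z}^{2n}$: (A1) $\eta(m,m')=0$; (A2) $\eta(m,a)+\mathrm{iso}(A)[a,m]=\eta(a,m)+[Aa,Am]$; (A3) $\eta(a,a')+\eta(a+a',a'')=\eta(a',a'')+\eta(a,a'+a'')$. Product: $(A_1,\eta_1)\cdot(A_2,\eta_2)=(A_1A_2,\tilde\eta)$ with $\tilde\eta(a,a')=\eta_1(A_2a,A_2a')+\mathrm{iso}(A_1)\eta_2(a,a')$. Morphisms $(A,\eta)\to(A',\eta')$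 exist only if $A=A'$ and are then smooth maps $\beta:\mathbb{R}^{2n}\to\mathrm{U}(1)$ with (A4) $\beta(m)=0$ for all $m\in\mathbb{Z}^{2n}$; (A5) $\beta(a_1)+\beta(a_2)+\eta(a_1,a_2)=\eta'(a_1,a_2)+\beta(a_1+a_2)$. Composition is pointwise addition. $\pi_0(\mathbb{A}_n)$ is the group of isomorphism classes of objects. *)

theory Defs
  imports "HOL-Analysis.Analysis" "HOL-Algebra.Group"
begin

section \<open>The group \<open>U(1) = \<real>/\<int>\<close>, written additively\<close>

quotient_type U1 = real / "\<lambda>x y. x - y \<in> \<int>"
  morphisms rep_U1 cls_U1
proof (rule equivpI)
  show "reflp (\<lambda>x y :: real. x - y \<in> \<int>)"
    by (simp add: reflp_def)
  show "symp (\<lambda>x y :: real. x - y \<in> \<int>)"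
  proof (rule sympI)
    fix x y :: real
    assume "x - y \<in> \<int>"
    then have "- (x - y) \<in> \<int>" by (rule Ints_minus)
    then show "y - x \<in> \<int>" by simp
  qed
  show "transp (\<lambda>x y :: real. x - y \<in> \<int>)"
  proof (rule transpI)
    fix x y z :: real
    assume "x - y \<in> \<int>" "y - z \<in> \<int>"
    then have "(x - y) + (y - z) \<in> \<int>" by (rule Ints_add)
    then show "x - z \<in> \<int>" by simp
  qed
qed

instantiation U1 :: ab_group_add
begin

lift_definition zero_U1 :: U1 is 0 .

lift_definition plus_U1 :: "U1 \<Rightarrow> U1 \<Rightarrow> U1" is "(+)"
  by (drule (1) Ints_add) (simp add: algebra_simps)

lift_definition uminus_U1 :: "U1 \<Rightarrow> U1" is uminus
  by (drule Ints_minus) simp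

lift_definition minus_U1 :: "U1 \<Rightarrow> U1 \<Rightarrow> U1" is "(-)"
  by (drule (1) Ints_diff) (simp add: algebra_simps)

instance
proof
  fix x y z :: U1
  show "x + y + z = x + (y + z)" by transfer (simp add: add.assoc)
  show "x + y = y + x" by transfer (simp add: add.commute)
  show "0 + x = x" by transfer simp
  show "- x + x = 0" by transfer simp
  show "x - y = x + - y" by transfer simp
qed

end

lift_definition int_mult_U1 :: "int \<Rightarrow> U1 \<Rightarrow> U1" (infixr \<open>\<bullet>\<^sub>\<int>\<close> 75) is
  "\<lambda>k x. of_int k * x"
  by (simp flip: right_diff_distrib)

section \<open>Smooth maps into \<open>U(1)\<close>\<close>

text \<open>Used only for open \<open>S\<close>.\<close>

primrec Ck_on :: "nat \<Rightarrow> 'a::euclidean_space set \<Rightarrow> ('a \<Rightarrow> real) \<Rightarrow> bool" where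
  "Ck_on 0 S f \<longleftrightarrow> continuous_on S f"
| "Ck_on (Suc k) S f \<longleftrightarrow>
     (\<forall>x\<in>S. f differentiable (at x)) \<and> (\<forall>v. Ck_on k S (\<lambda>x. frechet_derivative f (at x) v))"

definition smooth_real_on :: "'a::euclidean_space set \<Rightarrow> ('a \<Rightarrow> real) \<Rightarrow> bool" where
  "smooth_real_on S f \<longleftrightarrow> (\<forall>k. Ck_on k S f)"

text \<open>The manifold structure on \<open>\<real>/\<int>\<close> is the one making \<open>\<real> \<rightarrow> \<real>/\<int>\<close> a local diffeomorphism, so
  a map into \<open>\<real>/\<int>\<close> is smooth iff it locally has smooth real-valued lifts.\<close>

definition smooth_U1 :: "('a::euclidean_space \<Rightarrow> U1) \<Rightarrow> bool" where
  "smooth_U1 f \<longleftrightarrow>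
     (\<forall>x. \<exists>S g. open S \<and> x \<in> S \<and> smooth_real_on S g \<and> (\<forall>y\<in>S. f y = cls_U1 (g y)))"

section \<open>The group \<open>O\<^sup>\<plusminus>(n,n,\<int>)\<close>\<close>

text \<open>Here \<open>n = CARD('n)\<close>; the index type \<^typ>\<open>'n + 'n\<close> has \<^term>\<open>Inl\<close> for the first and
  \<^term>\<open>Inr\<close> for the last \<open>n\<close> coordinates.\<close>

type_synonym 'n vec2 = "real ^ ('n + 'n)"
type_synonym 'n mat2 = "int ^ ('n + 'n) ^ ('n + 'n)"

definition matI :: "'n::finite mat2" where
  "matI = (\<chi> i j. case (i, j) of
      (Inl k, Inr l) \<Rightarrow> if k = l then 1 else 0
    | (Inr k, Inl l) \<Rightarrow> if k = l then 1 else 0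
    | _ \<Rightarrow> 0)"

definition matJ :: "real ^ ('n::finite + 'n) ^ ('n + 'n)" where
  "matJ = (\<chi> i j. case (i, j) of
      (Inr k, Inl l) \<Rightarrow> if k = l then 1 else 0
    | _ \<Rightarrow> 0)"

definition bracket :: "'n::finite vec2 \<Rightarrow> 'n vec2 \<Rightarrow> real" where
  "bracket a b = a \<bullet> (matJ *v b)"

definition Opm :: "'n::finite mat2 set" where
  "Opm = {A. invertible A \<and>
     (transpose A ** matI ** A = matI \<or> transpose A ** matI ** A = - matI)}"

definition Opm_group :: "'n::finite mat2 monoid" where
  "Opm_group = \<lparr>carrier = Opm, mult = (**), one = mat 1\<rparr>"

text \<open>Meaningful on \<^term>\<open>Opm\<close>, where the two signs exclude each other since \<open>n \<ge> 1\<close>.\<close>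

definition iso_sign :: "'n::finite mat2 \<Rightarrow> int" where
  "iso_sign A = (if transpose A ** matI ** A = matI then 1 else - 1)"

definition act :: "'n::finite mat2 \<Rightarrow> 'n vec2 \<Rightarrow> 'n vec2" where
  "act A a = map_matrix of_int A *v a"

definition int_lattice :: "'n::finite vec2 set" where
  "int_lattice = {m. \<forall>i. m $ i \<in> \<int>}"

section \<open>The 2-group \<open>\<bbbA>\<^sub>n\<close> and \<open>\<pi>\<^sub>0\<close>\<close>

type_synonym 'n obj = "'n mat2 \<times> ('n vec2 \<Rightarrow> 'n vec2 \<Rightarrow> U1)"

definition Objs :: "'n::finite obj set" where
  "Objs = {(A, \<eta>). A \<in> Opm \<and> smooth_U1 (case_prod \<eta>) \<and>
     (\<forall>m\<in>int_lattice. \<forall>m'\<in>int_lattice. \<eta> m m' = 0) \<and>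
     (\<forall>a. \<forall>m\<in>int_lattice.
        \<eta> m a + iso_sign A \<bullet>\<^sub>\<int> cls_U1 (bracket a m) = \<eta> a m + cls_U1 (bracket (act A a) (act A m))) \<and>
     (\<forall>a a' a''. \<eta> a a' + \<eta> (a + a') a'' = \<eta> a' a'' + \<eta> a (a' + a''))}"

definition obj_mult :: "'n::finite obj \<Rightarrow> 'n obj \<Rightarrow> 'n obj" where
  "obj_mult = (\<lambda>(A\<^sub>1, \<eta>\<^sub>1) (A\<^sub>2, \<eta>\<^sub>2).
     (A\<^sub>1 ** A\<^sub>2, \<lambda>a a'. \<eta>\<^sub>1 (act A\<^sub>2 a) (act A\<^sub>2 a') + iso_sign A\<^sub>1 \<bullet>\<^sub>\<int> \<eta>\<^sub>2 a a'))"

definition obj_one :: "'n::finite obj" where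
  "obj_one = (mat 1, \<lambda>_ _. 0)"

definition Homs :: "'n::finite obj \<Rightarrow> 'n obj \<Rightarrow> ('n vec2 \<Rightarrow> U1) set" where
  "Homs = (\<lambda>(A, \<eta>) (A', \<eta>'). {\<beta>. A = A' \<and> smooth_U1 \<beta> \<and>
     (\<forall>m\<in>int_lattice. \<beta> m = 0) \<and>
     (\<forall>a b. \<beta> a + \<beta> b + \<eta> a b = \<eta>' a b + \<beta> (a + b))})"

definition hom_comp :: "('n::finite vec2 \<Rightarrow> U1) \<Rightarrow> ('n vec2 \<Rightarrow> U1) \<Rightarrow> 'n vec2 \<Rightarrow> U1" where
  "hom_comp \<gamma> \<beta> = (\<lambda>a. \<gamma> a + \<beta> a)"

definition hom_id :: "'n::finite vec2 \<Rightarrow> U1" where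
  "hom_id = (\<lambda>_. 0)"

definition iso_rel :: "('n::finite obj \<times> 'n obj) set" where
  "iso_rel = {(x, y). x \<in> Objs \<and> y \<in> Objs \<and>
     (\<exists>\<beta>\<in>Homs x y. \<exists>\<gamma>\<in>Homs y x. hom_comp \<gamma> \<beta> = hom_id \<and> hom_comp \<beta> \<gamma> = hom_id)}"

text \<open>The product of two classes is the class of the product of any representatives.\<close>

definition pi0 :: "'n::finite obj set monoid" where
  "pi0 = \<lparr>carrier = Objs // iso_rel,
     mult = (\<lambda>X Y. \<Union>x\<in>X. \<Union>y\<in>Y. iso_rel `` {obj_mult x y}),
     one = iso_rel `` {obj_one}\<rparr>"

definition projP :: "'n::finite obj set \<Rightarrow> 'n mat2" where
  "projP X = the_elem (fst ` X)"

section \<open>Basic checks\<close>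

lemma Ck_on_const: "Ck_on k S (\<lambda>_. c)"
proof (induction k arbitrary: c)
  case 0
  show ?case by simp
next
  case (Suc k)
  have "frechet_derivative (\<lambda>_::'a. c) (at x) = (\<lambda>_. 0)" for x
    by (rule frechet_derivative_at[symmetric]) simp
  then show ?case using Suc by simp
qed

lemma smooth_U1_zero: "smooth_U1 (\<lambda>_. 0)"
  unfolding smooth_U1_def smooth_real_on_def
proof
  fix x :: 'a
  show "\<exists>S g. open S \<and> x \<in> S \<and> (\<forall>k. Ck_on k S g) \<and> (\<forall>y\<in>S. 0 = cls_U1 (g y))"
    by (intro exI[of _ UNIV] exI[of _ "\<lambda>_. 0"]) (simp add: Ck_on_const zero_U1_def)
qed

lemma iso_rel_refl:
  assumes "x \<in> Objs"
  shows "(x, x) \<in> iso_rel"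
proof -
  have "hom_id \<in> Homs x x"
    by (cases x) (simp add: Homs_def hom_id_def smooth_U1_zero)
  moreover have "hom_comp hom_id hom_id = hom_id"
    by (simp add: hom_comp_def hom_id_def)
  ultimately show ?thesis
    using assms unfolding iso_rel_def by blast
qed

lemma projP_class:
  assumes "(A, \<eta>) \<in> Objs"
  shows "projP (iso_rel `` {(A, \<eta>)}) = A"
proof -
  have *: "fst y = A" if "y \<in> iso_rel `` {(A, \<eta>)}" for y
  proof -
    obtain B \<eta>' where y: "y = (B, \<eta>')" by (cases y)
    with that have "Homs (A, \<eta>) (B, \<eta>') \<noteq> {}"
      unfolding iso_rel_def by blast
    then show ?thesis using y by (auto simp: Homs_def)
  qed
  have "(A, \<eta>) \<in> iso_rel `` {(A, \<eta>)}"
    using iso_rel_refl[OF assms] by simp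
  then have "A \<in> fst ` (iso_rel `` {(A, \<eta>)})"
    by (rule image_eqI[rotated]) simp
  with * have "fst ` (iso_rel `` {(A, \<eta>)}) = {A}"
    by blast
  then show ?thesis by (simp add: projP_def)
qed

lemma matI_neq_uminus: "(matI :: 'n::finite mat2) \<noteq> - matI"
proof
  assume eq: "(matI :: 'n mat2) = - matI"
  fix k :: 'n
  have "(matI :: 'n mat2) $ Inl k $ Inr k = 1"
    by (simp add: matI_def)
  moreover have "(matI :: 'n mat2) $ Inl k $ Inr k = - ((matI :: 'n mat2) $ Inl k $ Inr k)"
    by (subst eq) simp
  ultimately show False by simp
qed

lemma iso_sign_eq:
  assumes "A \<in> Opm"
  shows "iso_sign A = 1 \<longleftrightarrow> transpose A ** matI ** A = matI"
    and "iso_sign A = - 1 \<longleftrightarrow> transpose A ** matI ** A = - matI"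
  using assms matI_neq_uminus by (auto simp: iso_sign_def Opm_def)

lemma bracket_eq_sum:
  fixes a b :: "'n::finite vec2"
  shows "bracket a b = (\<Sum>k\<in>UNIV. a $ Inr k * b $ Inl k)"
proof -
  have S: "sum f UNIV = (\<Sum>k\<in>UNIV. f (Inl k)) + (\<Sum>k\<in>UNIV. f (Inr k))"
    for f :: "'n + 'n \<Rightarrow> real"
    using sum.Plus[of "UNIV :: 'n set" "UNIV :: 'n set" f] by (simp add: o_def)
  have L: "(matJ *v b) $ Inl k = 0" for k
    by (simp add: matJ_def matrix_vector_mult_def S)
  have R: "(matJ *v b) $ Inr k = b $ Inl k" for k
  proof -
    have "(matJ *v b) $ Inr k = (\<Sum>l\<in>UNIV. (if k = l then 1 else 0) * b $ Inl l)"
      by (simp add: matJ_def matrix_vector_mult_def S)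
    also have "\<dots> = (\<Sum>l\<in>UNIV. if k = l then b $ Inl l else 0)"
      by (rule sum.cong) auto
    also have "\<dots> = b $ Inl k" by simp
    finally show ?thesis .
  qed
  show ?thesis by (simp add: bracket_def inner_vec_def S L R)
qed

end

theory Submission
  imports Defs
begin

text \<open>
The point is that an object is determined up to isomorphism by its matrix and that every matrix
occurs. Granting this, the isomorphism classes are exactly the fibres \<open>obj_class A\<close> of
\<open>(A, \<eta>) \<mapsto> A\<close>, and since multiplication of objects multiplies the matrices, the group axioms
for \<open>\<pi>\<^sub>0\<close> are those of \<open>O\<^sup>\<plusminus>(n,n,\<int>)\<close>, transported along \<open>A \<mapsto> obj_class A\<close>
(\<open>group_pi0\<close>). In particular no inverse objects have to be written down.

Every matrix occurs (\<open>Objs_exists\<close>). Any bilinear form \<open>\<eta>(a, b) = a \<bullet> X b\<close> mod 1 is a smooth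
cocycle, it vanishes on the lattice if \<open>X\<close> is integral, and the commutation condition follows from
\<open>X - X\<^sup>t = iso(A) J - A\<^sup>t J A\<close>. The right hand side is integral and antisymmetric, because \<open>J + J\<^sup>t = I\<close>
and \<open>A\<^sup>t I A = iso(A) I\<close>; so its strictly lower triangular part serves as \<open>X\<close>.

The matrix determines the object (\<open>iso_rel_same_matrix\<close>). The difference \<open>w\<close> of two cocycles over \<open>A\<close>
is a smooth \<open>U(1)\<close>-valued cocycle that vanishes on the lattice and satisfies \<open>w(m, a) = w(a, m)\<close> for
lattice points \<open>m\<close>, and \<open>smooth_U1_cocycle_trivial\<close> exhibits it as the coboundary of a
smooth function vanishing on the lattice:

  \<^item> The covering \<open>\<real> \<rightarrow> \<real>/\<int>\<close> lets \<open>w\<close> lift to a smooth real function \<open>W\<close>. Its coboundary is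
    continuous with integral values, hence constant, and it is zero at the origin; so \<open>W\<close> is a cocycle.
  \<^item> The commutator \<open>W(a, b) - W(b, a)\<close> of a cocycle is additive in each variable. For \<open>a\<close> in the
    lattice it is integral and depends continuously on \<open>b\<close>, hence it vanishes; being linear in
    \<open>a\<close> and zero on a basis, it vanishes identically. So \<open>W\<close> is symmetric.
  \<^item> A smooth symmetric real cocycle is the coboundary of a smooth function, found by integrating
    along rays the one-form that comes from differentiating \<open>W\<close>.
  \<^item> This function is additive modulo 1 on the lattice, and a linear correction, which leaves the
    coboundary unchanged, makes it integral on the standard basis and therefore on the lattice.
\<close>

section \<open>Smooth real functions\<close>

lemma Ck_on_imp_continuous_on: "Ck_on k S f \<Longrightarrow> continuous_on S f"
  by (cases k)
    (auto intro!: continuous_at_imp_continuous_on differentiable_imp_continuous_within)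

text \<open>Derivatives at a point depend only on the germ of the function, so differentiability can be
checked on an open neighbourhood of each point. This one statement covers restriction, congruence
and gluing.\<close>

lemma Ck_on_locally:
  assumes "\<And>x. x \<in> S \<Longrightarrow> \<exists>T g. open T \<and> x \<in> T \<and> Ck_on k T g \<and> (\<forall>y\<in>T. f y = g y)"
  shows "Ck_on k S f"
  using assms
proof (induction k arbitrary: f)
  case 0
  have "isCont f x" if "x \<in> S" for x
  proof -
    obtain T g where *: "open T" "x \<in> T" "continuous_on T g" "\<forall>y\<in>T. f y = g y"
      using "0.prems" \<open>x \<in> S\<close> unfolding Ck_on.simps by meson
    then have "continuous_on T f"
      using continuous_on_eq by metis
    then show ?thesis
      using * continuous_on_eq_continuous_at by blast
  qed
  then show ?case
    by (simp add: continuous_at_imp_continuous_on)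
next
  case (Suc k)
  have loc: "\<exists>T g. open T \<and> x \<in> T \<and> Ck_on (Suc k) T g \<and> (\<forall>y\<in>T. f y = g y) \<and>
     (\<forall>y\<in>T. f differentiable (at y) \<and> frechet_derivative f (at y) = frechet_derivative g (at y))"
    if x: "x \<in> S" for x
  proof -
    obtain T g where *: "open T" "x \<in> T" "Ck_on (Suc k) T g" "\<forall>y\<in>T. f y = g y"
      using Suc.prems[OF x] by blast
    have "(f has_derivative frechet_derivative g (at y)) (at y)" if "y \<in> T" for y
      by (rule has_derivative_transform_within_open[of g _ _ _ T])
        (use * that frechet_derivative_works in auto)
    then show ?thesis
      using * frechet_derivative_at unfolding differentiable_def by metis
  qed
  show ?case
    unfolding Ck_on.simps
  proof (intro conjI allI ballI)
    show "f differentiable (at x)" if "x \<in> S" for x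
      using loc[OF that] by blast
    show "Ck_on k S (\<lambda>x. frechet_derivative f (at x) v)" for v
    proof (rule Suc.IH)
      fix x assume "x \<in> S"
      from loc[OF this] obtain T g where T: "open T" "x \<in> T" "Ck_on (Suc k) T g" and
        eq: "\<forall>y\<in>T. f differentiable (at y) \<and> frechet_derivative f (at y) = frechet_derivative g (at y)"
        by (elim exE conjE) (rule that)
      have "Ck_on k T (\<lambda>y. frechet_derivative g (at y) v)"
        using T(3) by simp
      with T eq have "open T \<and> x \<in> T \<and> Ck_on k T (\<lambda>y. frechet_derivative g (at y) v) \<and>
          (\<forall>y\<in>T. frechet_derivative f (at y) v = frechet_derivative g (at y) v)"
        by simp
      then show "\<exists>T g. open T \<and> x \<in> T \<and> Ck_on k T g \<and>
          (\<forall>y\<in>T. frechet_derivative f (at y) v = g y)"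
        by (intro exI)
    qed
  qed
qed

lemma smooth_real_on_locally:
  assumes "\<And>x. x \<in> S \<Longrightarrow> \<exists>T g. open T \<and> x \<in> T \<and> smooth_real_on T g \<and> (\<forall>y\<in>T. f y = g y)"
  shows "smooth_real_on S f"
  unfolding smooth_real_on_def
proof
  show "Ck_on k S f" for k
    by (rule Ck_on_locally) (use assms in \<open>force simp: smooth_real_on_def\<close>)
qed

lemma smooth_real_on_subset:
  "smooth_real_on T g \<Longrightarrow> open T \<Longrightarrow> S \<subseteq> T \<Longrightarrow> smooth_real_on S g"
  by (rule smooth_real_on_locally) blast

lemma smooth_real_on_imp_continuous_on: "smooth_real_on S f \<Longrightarrow> continuous_on S f"
  using Ck_on_imp_continuous_on by (auto simp: smooth_real_on_def)

lemma smooth_real_on_differentiable: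
  assumes "smooth_real_on S f" and "x \<in> S"
  shows "(f has_derivative frechet_derivative f (at x)) (at x)"
proof -
  have "Ck_on (Suc 0) S f"
    using assms unfolding smooth_real_on_def by blast
  then show ?thesis
    using assms frechet_derivative_works by auto
qed

lemma smooth_real_on_frechet_derivative:
  assumes "smooth_real_on S f"
  shows "smooth_real_on S (\<lambda>x. frechet_derivative f (at x) v)"
proof -
  have "Ck_on (Suc k) S f" for k
    using assms unfolding smooth_real_on_def by blast
  then show ?thesis
    unfolding smooth_real_on_def by simp
qed

text \<open>Lets smoothness of a function be deduced from smoothness of a known derivative, without ever
differentiating the formula that defines the function. It is what turns a primitive given by an
integral into a smooth function without differentiating under the integral sign repeatedly.\<close>

lemma smooth_real_on_derivI:
  assumes D: "\<And>x. (f has_derivative D x) (at x)" and s: "\<And>v. smooth_real_on S (\<lambda>x. D x v)"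
  shows "smooth_real_on S f"
  unfolding smooth_real_on_def
proof
  have eq: "frechet_derivative f (at x) = D x" for x
    using frechet_derivative_at[OF D] by simp
  have d: "f differentiable (at x)" for x
    using D unfolding differentiable_def by blast
  show "Ck_on k S f" for k
  proof (cases k)
    case 0
    then show ?thesis
      using d by (auto intro!: continuous_at_imp_continuous_on differentiable_imp_continuous_within)
  next
    case (Suc l)
    then show ?thesis
      using s d by (simp add: eq smooth_real_on_def)
  qed
qed

lemma smooth_real_on_const: "smooth_real_on S (\<lambda>_. c)"
  by (simp add: smooth_real_on_def Ck_on_const)

lemma smooth_real_on_bounded_linear:
  assumes "bounded_linear f"
  shows "smooth_real_on S f"
  by (rule smooth_real_on_derivI[where D = "\<lambda>_. f"])
    (use assms in \<open>auto intro: bounded_linear_imp_has_derivative smooth_real_on_const\<close>)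

text \<open>The derivative of a linear combination is a formula that holds only on \<open>S\<close>; openness of \<open>S\<close>
turns this into equality of germs, which the induction on \<open>k\<close> needs.\<close>

lemma Ck_on_lincomb:
  assumes "open S"
  shows "Ck_on k S f \<Longrightarrow> Ck_on k S g \<Longrightarrow> Ck_on k S (\<lambda>x. r * f x + s * g x)"
proof (induction k arbitrary: f g)
  case 0
  then show ?case by (auto intro!: continuous_intros)
next
  case (Suc k)
  have D: "((\<lambda>x. r * f x + s * g x) has_derivative
      (\<lambda>v. r * frechet_derivative f (at x) v + s * frechet_derivative g (at x) v)) (at x)"
    if "x \<in> S" for x
    using Suc.prems that frechet_derivative_works by (auto intro!: derivative_intros)
  then have eq: "frechet_derivative (\<lambda>x. r * f x + s * g x) (at x) v =
      r * frechet_derivative f (at x) v + s * frechet_derivative g (at x) v" if "x \<in> S" for x v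
    using frechet_derivative_at[OF D[OF that]] by metis
  have "Ck_on k S (\<lambda>x. r * frechet_derivative f (at x) v + s * frechet_derivative g (at x) v)" for v
    using Suc by simp
  then have "Ck_on k S (\<lambda>x. frechet_derivative (\<lambda>x. r * f x + s * g x) (at x) v)" for v
    using eq \<open>open S\<close> by (intro Ck_on_locally) blast
  moreover have "(\<lambda>x. r * f x + s * g x) differentiable (at x)" if "x \<in> S" for x
    using D[OF that] by (rule differentiableI)
  ultimately show ?case
    by simp
qed

lemma smooth_real_on_lincomb:
  assumes "open S" "smooth_real_on S f" "smooth_real_on S g"
  shows "smooth_real_on S (\<lambda>x. r * f x + s * g x)"
  using assms Ck_on_lincomb unfolding smooth_real_on_def by blast

lemma Ck_on_compose_linear:
  fixes L :: "'a::euclidean_space \<Rightarrow> 'b::euclidean_space"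
  assumes L: "bounded_linear L" and T: "open T"
  shows "Ck_on k T f \<Longrightarrow> Ck_on k (L -` T) (\<lambda>x. f (L x))"
proof (induction k arbitrary: f)
  case 0
  then show ?case
    by (auto intro: continuous_on_compose2[of T f] linear_continuous_on L)
next
  case (Suc k)
  have D: "((\<lambda>x. f (L x)) has_derivative (\<lambda>v. frechet_derivative f (at (L x)) (L v))) (at x)"
    if "L x \<in> T" for x
    by (rule has_derivative_compose[OF bounded_linear_imp_has_derivative[OF L]])
      (use Suc.prems that frechet_derivative_works in auto)
  then have eq: "frechet_derivative (\<lambda>x. f (L x)) (at x) v = frechet_derivative f (at (L x)) (L v)"
    if "L x \<in> T" for x v
    using frechet_derivative_at[OF D[OF that]] by metis
  have "Ck_on k (L -` T) (\<lambda>x. frechet_derivative f (at (L x)) (L v))" for v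
    by (rule Suc.IH) (use Suc.prems in simp)
  moreover have "open (L -` T)"
    using L T linear_continuous_at by (intro continuous_open_vimage) (auto simp: continuous_at_imp_continuous_on)
  ultimately have "Ck_on k (L -` T) (\<lambda>x. frechet_derivative (\<lambda>x. f (L x)) (at x) v)" for v
    using eq by (intro Ck_on_locally) blast
  moreover have "(\<lambda>x. f (L x)) differentiable (at x)" if "L x \<in> T" for x
    using D[OF that] by (rule differentiableI)
  ultimately show ?case
    by simp
qed

lemma smooth_real_on_compose_linear:
  assumes "bounded_linear L" "open T" "smooth_real_on T f"
  shows "smooth_real_on (L -` T) (\<lambda>x. f (L x))"
  using assms Ck_on_compose_linear unfolding smooth_real_on_def by blast

text \<open>The derivative of a bilinear map in a fixed direction is linear, hence smooth.\<close>

lemma smooth_real_on_bounded_bilinear: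
  assumes "bounded_bilinear (h :: 'a::euclidean_space \<Rightarrow> 'b::euclidean_space \<Rightarrow> real)"
  shows "smooth_real_on S (case_prod h)"
proof -
  interpret bounded_bilinear h by fact
  show ?thesis
  proof (rule smooth_real_on_derivI)
    fix x :: "'a \<times> 'b"
    have "((\<lambda>x. h (fst x) (snd x)) has_derivative
        (\<lambda>v. h (fst x) (snd v) + h (fst v) (snd x))) (at x)"
      by (rule FDERIV) (auto intro!: derivative_eq_intros)
    then show "(case_prod h has_derivative (\<lambda>v. h (fst x) (snd v) + h (fst v) (snd x))) (at x)"
      by (simp add: case_prod_beta')
  next
    fix v :: "'a \<times> 'b"
    show "smooth_real_on S (\<lambda>x. h (fst x) (snd v) + h (fst v) (snd x))"
      by (intro smooth_real_on_bounded_linear bounded_linear_add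
          bounded_linear_compose[OF bounded_linear_left bounded_linear_fst]
          bounded_linear_compose[OF bounded_linear_right bounded_linear_snd])
  qed
qed

section \<open>The circle group and its universal covering\<close>

lemma cls_U1_eq_iff: "cls_U1 x = cls_U1 y \<longleftrightarrow> x - y \<in> \<int>"
  by (rule U1.abs_eq_iff)

lemma cls_U1_eq_0_iff: "cls_U1 x = 0 \<longleftrightarrow> x \<in> \<int>"
  by (simp add: zero_U1_def cls_U1_eq_iff)

lemma cls_U1_add: "cls_U1 (x + y) = cls_U1 x + cls_U1 y"
  by (simp add: plus_U1.abs_eq)

lemma cls_U1_diff: "cls_U1 (x - y) = cls_U1 x - cls_U1 y"
  by (simp add: minus_U1.abs_eq)

lemma int_mult_cls_U1: "k \<bullet>\<^sub>\<int> cls_U1 x = cls_U1 (of_int k * x)"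
  by (simp add: int_mult_U1.abs_eq)

lemma cls_U1_surj: obtains x where "u = cls_U1 x"
  by (metis Quotient3_U1 Quotient3_abs_rep)

lemma int_mult_U1_add: "k \<bullet>\<^sub>\<int> (x + y) = k \<bullet>\<^sub>\<int> x + k \<bullet>\<^sub>\<int> y"
  by transfer (simp add: algebra_simps)

lemma int_mult_U1_0 [simp]: "k \<bullet>\<^sub>\<int> 0 = 0"
  by transfer simp

lemma int_mult_U1_1 [simp]: "1 \<bullet>\<^sub>\<int> x = x"
  by transfer simp

lemma int_mult_U1_minus_1: "(- 1) \<bullet>\<^sub>\<int> x = - x"
  by transfer simp

lemma int_mult_U1_mult: "(k * l) \<bullet>\<^sub>\<int> x = k \<bullet>\<^sub>\<int> l \<bullet>\<^sub>\<int> x"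
  by transfer (simp add: algebra_simps)

lemma smooth_U1_cls: "smooth_real_on UNIV g \<Longrightarrow> smooth_U1 (\<lambda>x. cls_U1 (g x))"
  unfolding smooth_U1_def by blast

lemma smooth_U1_lincomb:
  assumes "smooth_U1 f" "smooth_U1 g"
  shows "smooth_U1 (\<lambda>x. k \<bullet>\<^sub>\<int> f x + l \<bullet>\<^sub>\<int> g x)"
  unfolding smooth_U1_def
proof
  fix x
  obtain S f' where f: "open S" "x \<in> S" "smooth_real_on S f'" "\<forall>y\<in>S. f y = cls_U1 (f' y)"
    using assms(1) unfolding smooth_U1_def by blast
  obtain T g' where g: "open T" "x \<in> T" "smooth_real_on T g'" "\<forall>y\<in>T. g y = cls_U1 (g' y)"
    using assms(2) unfolding smooth_U1_def by blast
  have "smooth_real_on (S \<inter> T) f'" "smooth_real_on (S \<inter> T) g'"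
    using smooth_real_on_subset[OF f(3,1)] smooth_real_on_subset[OF g(3,1)] by simp_all
  then have "smooth_real_on (S \<inter> T) (\<lambda>y. of_int k * f' y + of_int l * g' y)"
    using f g by (intro smooth_real_on_lincomb) auto
  then have "open (S \<inter> T) \<and> x \<in> S \<inter> T \<and>
      smooth_real_on (S \<inter> T) (\<lambda>y. of_int k * f' y + of_int l * g' y) \<and>
      (\<forall>y\<in>S \<inter> T. k \<bullet>\<^sub>\<int> f y + l \<bullet>\<^sub>\<int> g y = cls_U1 (of_int k * f' y + of_int l * g' y))"
    using f g by (simp add: cls_U1_add int_mult_cls_U1 open_Int)
  then show "\<exists>S h. open S \<and> x \<in> S \<and> smooth_real_on S h \<and>
      (\<forall>y\<in>S. k \<bullet>\<^sub>\<int> f y + l \<bullet>\<^sub>\<int> g y = cls_U1 (h y))"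
    by (intro exI)
qed

lemma smooth_U1_compose_linear:
  assumes "smooth_U1 f" and L: "bounded_linear L"
  shows "smooth_U1 (\<lambda>x. f (L x))"
  unfolding smooth_U1_def
proof
  fix x
  obtain S g where g: "open S" "L x \<in> S" "smooth_real_on S g" "\<forall>y\<in>S. f y = cls_U1 (g y)"
    using assms(1) unfolding smooth_U1_def by blast
  have "open (L -` S)"
    using L g linear_continuous_at by (intro continuous_open_vimage) (auto simp: continuous_at_imp_continuous_on)
  then have "open (L -` S) \<and> x \<in> L -` S \<and> smooth_real_on (L -` S) (\<lambda>y. g (L y)) \<and>
      (\<forall>y\<in>L -` S. f (L y) = cls_U1 (g (L y)))"
    using g smooth_real_on_compose_linear[OF L g(1,3)] by simp
  then show "\<exists>S h. open S \<and> x \<in> S \<and> smooth_real_on S h \<and> (\<forall>y\<in>S. f (L y) = cls_U1 (h y))"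
    by (intro exI)
qed

lemma continuous_Ints_valued_constant:
  fixes f :: "'a::topological_space \<Rightarrow> real"
  assumes "connected S" "continuous_on S f" and Z: "\<And>x. x \<in> S \<Longrightarrow> f x \<in> \<int>"
    and "x \<in> S" "y \<in> S"
  shows "f x = f y"
proof -
  have "1 \<le> norm (f y - f x)" if "x \<in> S" "y \<in> S" "f y \<noteq> f x" for x y
    using Ints_nonzero_abs_ge1[OF Ints_diff[OF Z[OF that(2)] Z[OF that(1)]]] that(3) by simp
  then have "\<exists>e>0. \<forall>y. y \<in> S \<and> f y \<noteq> f x \<longrightarrow> e \<le> norm (f y - f x)" if "x \<in> S" for x
    using that zero_less_one by blast
  then have "f constant_on S"
    by (rule continuous_discrete_range_constant[OF assms(1,2)])
  then show ?thesis
    using \<open>x \<in> S\<close> \<open>y \<in> S\<close> unfolding constant_on_def by auto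
qed

text \<open>Composed with \<open>t \<mapsto> exp (2 \<pi> i t)\<close>, a smooth map into the circle group becomes a
continuous map into the punctured plane, which has a continuous logarithm on a contractible space.
The imaginary part of the logarithm is a continuous lift, and on a ball it differs from any smooth
lift by an integer constant.\<close>

lemma smooth_U1_lift:
  fixes f :: "'a::euclidean_space \<Rightarrow> U1"
  assumes "smooth_U1 f"
  obtains g where "smooth_real_on UNIV g" "\<And>x. f x = cls_U1 (g x)"
proof -
  define e where "e u = exp (2 * pi * \<i> * complex_of_real (rep_U1 u))" for u
  have rep: "\<exists>k::int. rep_U1 (cls_U1 t) = t + of_int k" for t
  proof -
    have "cls_U1 (rep_U1 (cls_U1 t)) = cls_U1 t"
      by (metis Quotient3_U1 Quotient3_abs_rep)
    then have "rep_U1 (cls_U1 t) - t \<in> \<int>"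
      by (simp add: cls_U1_eq_iff)
    then obtain k :: int where "rep_U1 (cls_U1 t) - t = of_int k"
      by (rule Ints_cases)
    then show ?thesis
      by (intro exI[of _ k]) simp
  qed
  have e: "e (cls_U1 t) = exp (2 * pi * \<i> * complex_of_real t)" for t
  proof -
    obtain k :: int where "rep_U1 (cls_U1 t) = t + of_int k"
      using rep by blast
    then show ?thesis
      by (auto simp: e_def exp_eq algebra_simps intro!: exI[of _ k])
  qed
  have "continuous_on UNIV (\<lambda>x. e (f x))"
  proof (intro continuous_at_imp_continuous_on ballI)
    fix x
    obtain S g where g: "open S" "x \<in> S" "smooth_real_on S g" "\<forall>y\<in>S. f y = cls_U1 (g y)"
      using assms unfolding smooth_U1_def by blast
    have "continuous_on S (\<lambda>y. exp (2 * pi * \<i> * complex_of_real (g y)))"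
      using smooth_real_on_imp_continuous_on[OF g(3)] by (intro continuous_intros)
    then have "continuous_on S (\<lambda>y. e (f y))"
      using g by (simp add: e cong: continuous_on_cong)
    then show "isCont (\<lambda>x. e (f x)) x"
      using g continuous_on_eq_continuous_at by blast
  qed
  then obtain L where L: "continuous_on UNIV L" "\<And>x. e (f x) = exp (L x)"
    using continuous_logarithm_on_contractible[of UNIV "\<lambda>x. e (f x)"]
    by (auto simp: e_def)
  define h where "h x = Im (L x) / (2 * pi)" for x
  have h: "cls_U1 (h x) = f x" for x
  proof -
    obtain t where t: "f x = cls_U1 t" by (rule cls_U1_surj)
    have "exp (L x) = exp (2 * pi * \<i> * complex_of_real t)"
      using L(2)[of x] by (simp add: t e)
    then obtain k :: int where "L x = 2 * pi * \<i> * complex_of_real t + (of_int (2 * k) * pi) * \<i>"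
      unfolding exp_eq by blast
    then have "Im (L x) = 2 * pi * (t + of_int k)"
      by (simp add: algebra_simps)
    then have "h x = t + of_int k"
      by (simp add: h_def)
    then show ?thesis
      by (simp add: t cls_U1_eq_iff)
  qed
  have conth: "continuous_on UNIV h"
    unfolding h_def using L(1) by (intro continuous_intros) auto
  have "smooth_real_on UNIV h"
  proof (rule smooth_real_on_locally)
    fix x :: 'a
    obtain S g where g: "open S" "x \<in> S" "smooth_real_on S g" "\<forall>y\<in>S. f y = cls_U1 (g y)"
      using assms unfolding smooth_U1_def by blast
    obtain r where r: "r > 0" "ball x r \<subseteq> S"
      using g open_contains_ball by blast
    have sg: "smooth_real_on (ball x r) g"
      by (rule smooth_real_on_subset[OF g(3,1) r(2)])
    have "h y - g y = h x - g x" if "y \<in> ball x r" for y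
    proof (rule continuous_Ints_valued_constant[of "ball x r" "\<lambda>y. h y - g y"])
      show "continuous_on (ball x r) (\<lambda>y. h y - g y)"
        by (intro continuous_intros smooth_real_on_imp_continuous_on[OF sg]
            continuous_on_subset[OF conth]) auto
      show "h y - g y \<in> \<int>" if "y \<in> ball x r" for y
        using that r g(4) h[of y] by (auto simp flip: cls_U1_eq_iff)
    qed (use that r in auto)
    then have "\<forall>y\<in>ball x r. h y = 1 * g y + 1 * (h x - g x)"
      by (simp add: algebra_simps)
    moreover have "smooth_real_on (ball x r) (\<lambda>y. 1 * g y + 1 * (h x - g x))"
      by (intro smooth_real_on_lincomb sg smooth_real_on_const) auto
    moreover have "open (ball x r)" "x \<in> ball x r"
      using r by simp_all
    ultimately show "\<exists>T g. open T \<and> x \<in> T \<and> smooth_real_on T g \<and> (\<forall>y\<in>T. h y = g y)"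
      by (intro exI conjI)
  qed
  then show ?thesis
    by (rule that) (simp add: h)
qed

section \<open>Smooth cocycles on Euclidean space\<close>

text \<open>The 2-cocycle condition of group cohomology, for the trivial action of the first group on the
second.\<close>

definition cocycle2 :: "('a::ab_group_add \<Rightarrow> 'a \<Rightarrow> 'b::ab_group_add) \<Rightarrow> bool" where
  "cocycle2 w \<longleftrightarrow> (\<forall>a b c. w a b + w (a + b) c = w b c + w a (b + c))"

lemma cocycle2D: "cocycle2 w \<Longrightarrow> w a b + w (a + b) c = w b c + w a (b + c)"
  by (simp add: cocycle2_def)

lemma cocycle2_zero:
  assumes "cocycle2 w"
  shows "w 0 a = w 0 0" and "w a 0 = w 0 0"
  using cocycle2D[OF assms, of 0 0 a] cocycle2D[OF assms, of a 0 0] by simp_all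

text \<open>The commutator of a cocycle is the commutator pairing of the corresponding central extension of
an abelian group, and such pairings are bimultiplicative. In formulas, three instances of the cocycle
identity suffice.\<close>

lemma cocycle2_commutator_add:
  fixes w :: "'a::ab_group_add \<Rightarrow> 'a \<Rightarrow> 'b::ab_group_add"
  assumes "cocycle2 w"
  shows "w (a + b) c - w c (a + b) = (w a c - w c a) + (w b c - w c b)"
proof -
  have 1: "w (a + b) c = w b c + w a (b + c) - w a b"
    using cocycle2D[OF assms, of a b c] by (simp add: algebra_simps)
  have 2: "w c (a + b) = w c a + w (a + c) b - w a b"
    using cocycle2D[OF assms, of c a b] by (simp add: algebra_simps)
  have 3: "w (a + c) b = w c b + w a (b + c) - w a c"
    using cocycle2D[OF assms, of a c b] by (simp add: algebra_simps)
  show ?thesis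
    unfolding 1 2 3 by (simp add: algebra_simps)
qed

text \<open>The lift of a cocycle fails to be a cocycle by a continuous integral function on a connected
space, which is constant; at the origin all four terms agree.\<close>

lemma smooth_cocycle_lift:
  fixes w :: "'a::euclidean_space \<Rightarrow> 'a \<Rightarrow> U1"
  assumes "smooth_U1 (case_prod w)" and w: "cocycle2 w"
  obtains W where "smooth_real_on UNIV (case_prod W)" "\<And>a b. w a b = cls_U1 (W a b)" "cocycle2 W"
proof -
  obtain g where g: "smooth_real_on UNIV g" "\<And>p. case_prod w p = cls_U1 (g p)"
    using smooth_U1_lift[OF assms(1)] by metis
  define W where "W a b = g (a, b)" for a b
  have W: "w a b = cls_U1 (W a b)" for a b
    using g(2)[of "(a, b)"] by (simp add: W_def)
  define d where "d p = (case p of (a, b, c) \<Rightarrow> W a b + W (a + b) c - (W b c + W a (b + c)))" for p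
  have contg: "continuous_on UNIV g"
    using g(1) by (rule smooth_real_on_imp_continuous_on)
  have "continuous_on UNIV d"
    unfolding d_def W_def case_prod_beta
    by (intro continuous_intros continuous_on_compose2[OF contg]) auto
  moreover have "d p \<in> \<int>" for p
  proof -
    obtain a b c where p: "p = (a, b, c)" by (cases p)
    have "cls_U1 (W a b + W (a + b) c) = cls_U1 (W b c + W a (b + c))"
      using cocycle2D[OF w, of a b c] by (simp only: W cls_U1_add)
    then show ?thesis
      by (simp only: p d_def prod.case cls_U1_eq_iff)
  qed
  ultimately have "d p = d 0" for p
    by (intro continuous_Ints_valued_constant[of UNIV]) auto
  then have "d (a, b, c) = d (0, 0, 0)" for a b c
    by (simp add: zero_prod_def)
  then have "cocycle2 W"
    by (simp add: cocycle2_def d_def)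
  moreover have "case_prod W = g"
    by (auto simp: W_def fun_eq_iff)
  then have "smooth_real_on UNIV (case_prod W)"
    using g(1) by simp
  ultimately show ?thesis
    using W that by blast
qed

text \<open>Additivity carries the derivative at the origin to every other point, so \<open>f - L\<close> has derivative
zero everywhere.\<close>

lemma additive_differentiable_eq_derivative:
  fixes f :: "'a::real_normed_vector \<Rightarrow> real"
  assumes add: "\<And>x y. f (x + y) = f x + f y" and D: "(f has_derivative L) (at 0)"
  shows "f = L"
proof
  fix x
  have L: "bounded_linear L"
    using D by (rule has_derivative_bounded_linear)
  have "((\<lambda>z. f z - L z) has_derivative (\<lambda>_. 0)) (at y)" for y
  proof -
    have "(f has_derivative L) (at (y - y))"
      using D by simp
    moreover have "((\<lambda>z. z - y) has_derivative (\<lambda>v. v)) (at y)"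
      by (auto intro!: derivative_eq_intros)
    ultimately have "((\<lambda>z. f (z - y)) has_derivative L) (at y)"
      using has_derivative_compose[of "\<lambda>z. z - y" "\<lambda>v. v" y UNIV f L] by simp
    then have "((\<lambda>z. f y + f (z - y)) has_derivative L) (at y)"
      by (auto intro!: derivative_eq_intros)
    then have "(f has_derivative L) (at y)"
      by (simp flip: add)
    from has_derivative_diff[OF this bounded_linear_imp_has_derivative[OF L]]
    show ?thesis by simp
  qed
  then have "f x - L x = f 0 - L 0"
    by (intro has_derivative_zero_unique[of UNIV "\<lambda>z. f z - L z"]) auto
  moreover have "f 0 = 0"
    using add[of 0 0] by simp
  moreover have "L 0 = 0"
    using L by (rule linear_0[OF bounded_linear.linear])
  ultimately show "f x = L x" by simp
qed

lemma smooth_real_cocycle_symmetric: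
  fixes W :: "'a::euclidean_space \<Rightarrow> 'a \<Rightarrow> real"
  assumes smooth: "smooth_real_on UNIV (case_prod W)" and W: "cocycle2 W"
    and Z: "\<And>i a. i \<in> Basis \<Longrightarrow> W i a - W a i \<in> \<int>"
  shows "W a b = W b a"
proof -
  define k where "k x = W x b - W b x" for x
  have cont: "continuous_on UNIV (case_prod W)"
    using smooth by (rule smooth_real_on_imp_continuous_on)
  have basis: "k i = 0" if "i \<in> Basis" for i
  proof -
    have "continuous_on UNIV (\<lambda>y. case_prod W (i, y) - case_prod W (y, i))"
      by (intro continuous_intros continuous_on_compose2[OF cont]) auto
    then have "W i b - W b i = W i 0 - W 0 i"
      using Z[OF that] by (intro continuous_Ints_valued_constant[of UNIV "\<lambda>y. W i y - W y i"]) auto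
    then show ?thesis
      unfolding k_def using cocycle2_zero(1)[OF W, of i] cocycle2_zero(2)[OF W, of i] by simp
  qed
  have add: "k (x + y) = k x + k y" for x y
    unfolding k_def by (rule cocycle2_commutator_add[OF W])
  have "(\<lambda>x. (x, b)) differentiable (at 0)" "(\<lambda>x. (b, x)) differentiable (at 0)"
    by (auto intro!: differentiableI derivative_eq_intros)
  moreover have "case_prod W differentiable (at p)" for p
    by (rule differentiableI[OF smooth_real_on_differentiable[OF smooth UNIV_I]])
  ultimately have "(\<lambda>x. case_prod W (x, b)) differentiable (at 0)"
    "(\<lambda>x. case_prod W (b, x)) differentiable (at 0)"
    using differentiable_compose[of "case_prod W" "\<lambda>x. (x, b)"]
      differentiable_compose[of "case_prod W" "\<lambda>x. (b, x)"] by blast+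
  then have "k differentiable (at 0)"
    unfolding k_def by (simp add: differentiable_diff)
  then obtain L where L: "(k has_derivative L) (at 0)"
    unfolding differentiable_def by blast
  have kL: "k = L"
    by (rule additive_differentiable_eq_derivative[OF add L])
  then have "linear k"
    using has_derivative_bounded_linear[OF L] bounded_linear.linear by blast
  then have "k = (\<lambda>_. 0)"
    by (rule linear_eq_stdbasis) (use basis in \<open>auto simp: linear_iff\<close>)
  then show ?thesis
    by (metis k_def eq_iff_diff_eq_0)
qed

text \<open>Write \<open>\<theta>\<^sub>a(v)\<close> for the derivative of \<open>x \<mapsto> W(x, a)\<close> at \<open>0\<close> in direction \<open>v\<close>. If \<open>W\<close> is to be
\<open>F(a + b) - F(a) - F(b)\<close> up to a constant with \<open>F\<close> critical at the origin, then \<open>F\<close> must have derivative \<open>\<theta>\<close>;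
this suggests \<open>F(a) = \<integral>\<^sub>0\<^sup>1 \<theta>\<^sub>t\<^sub>a(a) dt\<close>. Differentiating the cocycle identity shows that both partial derivatives
of \<open>W\<close> are differences of values of \<open>\<theta>\<close>, the second one by symmetry. Hence the derivative of
\<open>t \<mapsto> W(t a, t b)\<close> is the integrand of \<open>F(a + b) - F(a) - F(b)\<close>, and the fundamental theorem of calculus
gives the coboundary identity without proving first that \<open>\<theta>\<close> is closed. Conversely that identity
reduces differentiability of \<open>F\<close> at any point to the origin, where it is an elementary estimate.\<close>

lemma smooth_symmetric_cocycle_coboundary:
  fixes W :: "'a::euclidean_space \<Rightarrow> 'a \<Rightarrow> real"
  assumes smooth: "smooth_real_on UNIV (case_prod W)" and W: "cocycle2 W"
    and sym: "\<And>a b. W a b = W b a"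
  obtains G where "smooth_real_on UNIV G" "\<And>a b. W a b = G a + G b - G (a + b)"
proof -
  define D where "D p = frechet_derivative (case_prod W) (at p)" for p
  define \<theta> where "\<theta> a v = D (0, a) (v, 0)" for a v
  have D: "(case_prod W has_derivative D p) (at p)" for p
    unfolding D_def by (rule smooth_real_on_differentiable[OF smooth]) simp
  have linD: "linear (D p)" for p
    using has_derivative_bounded_linear[OF D] bounded_linear.linear by blast
  have D1: "((\<lambda>x. W (x + a) b) has_derivative (\<lambda>v. D (y + a, b) (v, 0))) (at y)" for y a b
  proof -
    have "((\<lambda>x. (x + a, b)) has_derivative (\<lambda>v. (v, 0))) (at y)"
      by (auto intro!: derivative_eq_intros)
    from has_derivative_compose[OF this D] show ?thesis by simp
  qed
  have D2: "((\<lambda>x. W a (x + b)) has_derivative (\<lambda>v. D (a, y + b) (0, v))) (at y)" for y a b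
  proof -
    have "((\<lambda>x. (a, x + b)) has_derivative (\<lambda>v. (0, v))) (at y)"
      by (auto intro!: derivative_eq_intros)
    from has_derivative_compose[OF this D] show ?thesis by simp
  qed
  \<comment> \<open>The cocycle identity for \<open>(x, a, b)\<close>, differentiated in \<open>x\<close> at the origin.\<close>
  have left: "D (a, b) (v, 0) = \<theta> (a + b) v - \<theta> a v" for a b v
  proof -
    have "W (x + a) b = W a b + W (x + 0) (a + b) - W (x + 0) a" for x
      using cocycle2D[OF W, of x a b] by simp
    moreover have "((\<lambda>x. W a b + W (x + 0) (a + b) - W (x + 0) a) has_derivative
        (\<lambda>v. 0 + D (0 + 0, a + b) (v, 0) - D (0 + 0, a) (v, 0))) (at 0)"
      by (intro has_derivative_diff has_derivative_add has_derivative_const D1)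
    ultimately have "((\<lambda>x. W (x + a) b) has_derivative (\<lambda>v. \<theta> (a + b) v - \<theta> a v)) (at 0)"
      by (simp add: \<theta>_def)
    from has_derivative_unique[OF D1 this] show ?thesis
      by (metis add_0)
  qed
  have right: "D (a, b) (0, v) = \<theta> (a + b) v - \<theta> b v" for a b v
  proof -
    have "((\<lambda>x. W a (x + b)) has_derivative (\<lambda>v. D (b, a) (v, 0))) (at 0)"
      using D1[of b a 0] by (simp add: sym[of a])
    from has_derivative_unique[OF D2 this] have "D (a, b) (0, v) = D (b, a) (v, 0)"
      by (metis add_0)
    then show ?thesis
      by (simp add: left add.commute)
  qed
  have smoothD: "smooth_real_on UNIV (\<lambda>p. D p v)" for v
    unfolding D_def by (rule smooth_real_on_frechet_derivative[OF smooth])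
  have smooth\<theta>: "smooth_real_on UNIV (\<lambda>a. \<theta> a v)" for v
    using smooth_real_on_compose_linear[OF _ open_UNIV smoothD, of "\<lambda>a. (0, a)"]
    by (simp add: \<theta>_def bounded_linear_Pair bounded_linear_zero bounded_linear_ident)
  have cont\<theta>: "continuous_on UNIV (\<lambda>a. \<theta> a v)" for v
    by (rule smooth_real_on_imp_continuous_on[OF smooth\<theta>])
  have contray: "continuous_on {0..1} (\<lambda>t. \<theta> (t *\<^sub>R a) a)" for a
    by (intro continuous_on_compose2[OF cont\<theta>] continuous_intros) auto
  define F where "F a = integral {0..1} (\<lambda>t. \<theta> (t *\<^sub>R a) a)" for a
  have F: "((\<lambda>t. \<theta> (t *\<^sub>R a) a) has_integral F a) {0..1}" for a
    unfolding F_def by (intro integrable_integral integrable_continuous_real contray)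
  have dF: "F (a + b) - F a - F b = W a b - W 0 0" for a b
  proof -
    let ?f = "\<lambda>t. \<theta> (t *\<^sub>R (a + b)) (a + b) - \<theta> (t *\<^sub>R a) a - \<theta> (t *\<^sub>R b) b"
    have "((\<lambda>t. W (t *\<^sub>R a) (t *\<^sub>R b)) has_vector_derivative ?f t) (at t within {0..1})" for t
    proof -
      have "((\<lambda>t. case_prod W (t *\<^sub>R a, t *\<^sub>R b)) has_derivative
          (\<lambda>s. D (t *\<^sub>R a, t *\<^sub>R b) (s *\<^sub>R a, s *\<^sub>R b))) (at t within {0..1})"
        by (rule has_derivative_compose[OF _ D]) (auto intro!: derivative_eq_intros)
      moreover have "D (t *\<^sub>R a, t *\<^sub>R b) (s *\<^sub>R a, s *\<^sub>R b) = s *\<^sub>R ?f t" for s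
      proof -
        let ?D = "D (t *\<^sub>R a, t *\<^sub>R b)"
        have lin\<theta>: "\<theta> x (v + v') = \<theta> x v + \<theta> x v'" for x v v'
          using linear_add[OF linD, of "(0, x)" "(v, 0)" "(v', 0)"] by (simp add: \<theta>_def)
        have "?D (s *\<^sub>R a, s *\<^sub>R b) = s *\<^sub>R ?D (a, b)"
          using linear_cmul[OF linD, of _ s "(a, b)"] by simp
        also have "?D (a, b) = ?D (a, 0) + ?D (0, b)"
          using linear_add[OF linD, of _ "(a, 0)" "(0, b)"] by simp
        also have "\<dots> = ?f t"
          unfolding left right lin\<theta> by (simp add: scaleR_right_distrib)
        finally show ?thesis .
      qed
      ultimately show ?thesis
        by (simp add: has_vector_derivative_def)
    qed
    then have "(?f has_integral W (1 *\<^sub>R a) (1 *\<^sub>R b) - W (0 *\<^sub>R a) (0 *\<^sub>R b)) {0..1}"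
      by (intro fundamental_theorem_of_calculus) auto
    then have 1: "(?f has_integral W a b - W 0 0) {0..1}"
      by simp
    have 2: "(?f has_integral F (a + b) - F a - F b) {0..1}"
      by (intro has_integral_diff F)
    show ?thesis
      by (rule has_integral_unique[OF 2 1])
  qed
  have F0: "F 0 = 0"
    using dF[of 0 0] by simp
  have \<theta>0: "\<theta> 0 v = 0" for v
    using left[of 0 0 v] by (simp add: \<theta>_def)
  \<comment> \<open>Since \<open>\<theta>\<close> is continuous and vanishes at the origin, \<open>\<bar>\<theta>\<^sub>x(v)\<bar> \<le> e \<cdot> \<parallel>v\<parallel>\<close> for small \<open>x\<close>. Continuity is known
    only for each fixed \<open>v\<close>, so the bound is first obtained on the basis, with \<open>e\<close> shared among
    its elements.\<close>
  have DF0: "(F has_derivative (\<lambda>_. 0)) (at 0)"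
    unfolding has_derivative_at_alt
  proof (intro conjI allI impI)
    fix e :: real assume "e > 0"
    define e' where "e' = e / DIM('a)"
    have e': "e' > 0" "e' * DIM('a) = e"
      using \<open>e > 0\<close> by (auto simp: e'_def)
    have "\<forall>i\<in>Basis. \<exists>d>0. \<forall>x::'a. norm x < d \<longrightarrow> \<bar>\<theta> x i\<bar> < e'"
    proof
      fix i :: 'a
      have "isCont (\<lambda>x. \<theta> x i) 0"
        using cont\<theta> by (simp add: continuous_on_eq_continuous_at)
      then show "\<exists>d>0. \<forall>x. norm x < d \<longrightarrow> \<bar>\<theta> x i\<bar> < e'"
        using e'(1) unfolding continuous_at_eps_delta by (simp add: \<theta>0 dist_norm)
    qed
    then obtain d where d: "\<And>i. i \<in> Basis \<Longrightarrow> d i > 0"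
      "\<And>i x::'a. i \<in> Basis \<Longrightarrow> norm x < d i \<Longrightarrow> \<bar>\<theta> x i\<bar> < e'"
      by metis
    define d' where "d' = Min (d ` Basis)"
    have "d' > 0"
      unfolding d'_def using d(1) by (subst Min_gr_iff) auto
    moreover have "norm (F h) \<le> e * norm h" if h: "norm h < d'" for h
    proof -
      have "norm (\<theta> (t *\<^sub>R h) h) \<le> e * norm h" if t: "t \<in> {0..1}" for t
      proof -
        have "norm (t *\<^sub>R h) \<le> norm h"
          using t by (simp add: mult_left_le_one_le)
        then have "norm (t *\<^sub>R h) < d i" if "i \<in> Basis" for i
          using h that Min_le[of "d ` Basis" "d i"] by (auto simp: d'_def)
        then have small: "\<bar>\<theta> (t *\<^sub>R h) i\<bar> \<le> e'" if "i \<in> Basis" for i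
          using d(2)[OF that] that less_imp_le by blast
        have lin\<theta>: "linear (\<lambda>v. \<theta> x v)" for x
          using linear_compose[OF _ linD, of "\<lambda>v. (v, 0)"]
          by (simp add: \<theta>_def o_def linear_iff)
        have "\<theta> (t *\<^sub>R h) h = \<theta> (t *\<^sub>R h) (\<Sum>i\<in>Basis. (h \<bullet> i) *\<^sub>R i)"
          by (simp add: euclidean_representation)
        also have "\<dots> = (\<Sum>i\<in>Basis. (h \<bullet> i) * \<theta> (t *\<^sub>R h) i)"
          by (simp add: linear_sum[OF lin\<theta>] linear_cmul[OF lin\<theta>])
        also have "\<bar>\<dots>\<bar> \<le> (\<Sum>i\<in>(Basis :: 'a set). norm h * e')"
        proof (rule order_trans[OF sum_abs], rule sum_mono)
          fix i :: 'a assume "i \<in> Basis"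
          then show "\<bar>(h \<bullet> i) * \<theta> (t *\<^sub>R h) i\<bar> \<le> norm h * e'"
            unfolding abs_mult by (intro mult_mono Basis_le_norm small) auto
        qed
        also have "\<dots> = e * norm h"
          using e'(2) by (simp add: mult.commute mult.left_commute)
        finally show ?thesis by simp
      qed
      from integral_bound[OF zero_le_one contray this] show ?thesis
        by (simp add: F_def)
    qed
    ultimately show "\<exists>d>0. \<forall>y. norm (y - 0) < d \<longrightarrow> norm (F y - F 0 - 0) \<le> e * norm (y - 0)"
      by (auto simp: F0)
  qed simp
  have DF: "(F has_derivative \<theta> a) (at a)" for a
  proof -
    \<comment> \<open>The coboundary identity for \<open>(y - a, a)\<close> moves the question to the origin.\<close>
    have eq: "(\<lambda>y. F a + F (y - a) + W (y - a) a - W 0 0) = F"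
    proof
      show "F a + F (y - a) + W (y - a) a - W 0 0 = F y" for y
        using dF[of "y - a" a] by simp
    qed
    have "((\<lambda>y. F a + F (y - a) + W (y - a) a - W 0 0) has_derivative
        (\<lambda>v. 0 + 0 + \<theta> a v - 0)) (at a)"
    proof (intro has_derivative_add has_derivative_diff has_derivative_const)
      show "((\<lambda>y. F (y - a)) has_derivative (\<lambda>_. 0)) (at a)"
        by (rule has_derivative_compose[where g = F and g' = "\<lambda>_. 0" and f' = "\<lambda>v. v"])
          (auto intro!: derivative_eq_intros DF0)
      show "((\<lambda>y. W (y - a) a) has_derivative \<theta> a) (at a)"
        using D1[of "- a" a a] by (simp add: \<theta>_def[abs_def])
    qed
    then show ?thesis
      unfolding eq by simp
  qed
  have "smooth_real_on UNIV F"
    by (rule smooth_real_on_derivI[OF DF smooth\<theta>])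
  \<comment> \<open>The witness is \<open>W 0 0 - F\<close>, spelled as a linear combination so that its smoothness is an instance of
    \<open>smooth_real_on_lincomb\<close>.\<close>
  then have "smooth_real_on UNIV (\<lambda>a. 1 * W 0 0 + (-1) * F a)"
    by (intro smooth_real_on_lincomb smooth_real_on_const) auto
  moreover have "W a b = (1 * W 0 0 + (-1) * F a) + (1 * W 0 0 + (-1) * F b) -
      (1 * W 0 0 + (-1) * F (a + b))" for a b
    using dF[of a b] by simp
  ultimately show ?thesis
    by (rule that)
qed

text \<open>Modulo 1, \<open>B\<close> is a homomorphism on the lattice, and the standard basis generates the lattice.\<close>

lemma integral_on_lattice_if_additive_mod_1:
  fixes B :: "'a::euclidean_space \<Rightarrow> real"
  assumes add: "\<And>m m'. (\<forall>i\<in>Basis. m \<bullet> i \<in> \<int>) \<Longrightarrow> (\<forall>i\<in>Basis. m' \<bullet> i \<in> \<int>) \<Longrightarrow>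
      B (m + m') - B m - B m' \<in> \<int>"
    and basis: "\<And>i. i \<in> Basis \<Longrightarrow> B i \<in> \<int>"
    and m: "\<forall>i\<in>Basis. m \<bullet> i \<in> \<int>"
  shows "B m \<in> \<int>"
proof -
  define H where "H = {m. (\<forall>i\<in>Basis. m \<bullet> i \<in> \<int>) \<and> B m \<in> \<int>}"
  have H0: "0 \<in> H"
    using add[of 0 0] by (simp add: H_def)
  have Hadd: "x + y \<in> H" if "x \<in> H" "y \<in> H" for x y
  proof -
    have "B (x + y) - B x - B y \<in> \<int>"
      using that by (intro add) (auto simp: H_def)
    then have "(B (x + y) - B x - B y) + B x + B y \<in> \<int>"
      using that by (intro Ints_add) (auto simp: H_def)
    then show ?thesis
      using that by (auto simp: H_def inner_add_left)
  qed
  have Hneg: "- x \<in> H" if "x \<in> H" for x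
  proof -
    have "B (x + - x) - B x - B (- x) \<in> \<int>"
      using that by (intro add) (auto simp: H_def)
    then have "B 0 - B x - (B (x + - x) - B x - B (- x)) \<in> \<int>"
      using that H0 by (intro Ints_diff) (auto simp: H_def)
    then show ?thesis
      using that H0 by (simp add: H_def)
  qed
  have Hmult: "of_int k *\<^sub>R x \<in> H" if "x \<in> H" for k x
  proof (induction k rule: int_induct[where k = 0])
    case base
    then show ?case using H0 by simp
  next
    case (step1 k)
    then show ?case using Hadd[OF _ that, of "of_int k *\<^sub>R x"] by (simp add: algebra_simps)
  next
    case (step2 k)
    then show ?case using Hadd[OF _ Hneg[OF that], of "of_int k *\<^sub>R x"] by (simp add: algebra_simps)
  qed
  have HB: "i \<in> H" if "i \<in> Basis" for i
    using basis[OF that] that by (auto simp: H_def inner_Basis)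
  have "(m \<bullet> i) *\<^sub>R i \<in> H" if i: "i \<in> Basis" for i
  proof -
    obtain k where "m \<bullet> i = of_int k"
      using m i Ints_cases by blast
    then show ?thesis
      using Hmult[OF HB[OF i]] by simp
  qed
  moreover have "(\<Sum>i\<in>A. (m \<bullet> i) *\<^sub>R i) \<in> H"
    if "finite A" "\<And>i. i \<in> A \<Longrightarrow> (m \<bullet> i) *\<^sub>R i \<in> H" for A
    using that by (induction A rule: finite_induct) (auto intro: H0 Hadd)
  ultimately have "(\<Sum>i\<in>Basis. (m \<bullet> i) *\<^sub>R i) \<in> H"
    by simp
  then show ?thesis
    by (simp add: euclidean_representation H_def)
qed

lemma smooth_U1_cocycle_trivial:
  fixes w :: "'a::euclidean_space \<Rightarrow> 'a \<Rightarrow> U1" and \<Lambda> :: "'a set"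
  defines "\<Lambda> \<equiv> {m. \<forall>i\<in>Basis. m \<bullet> i \<in> \<int>}"
  assumes smooth: "smooth_U1 (case_prod w)" and w: "cocycle2 w"
    and zero: "\<And>m m'. m \<in> \<Lambda> \<Longrightarrow> m' \<in> \<Lambda> \<Longrightarrow> w m m' = 0"
    and comm: "\<And>m a. m \<in> \<Lambda> \<Longrightarrow> w m a = w a m"
  obtains \<beta> where "smooth_U1 \<beta>" "\<And>m. m \<in> \<Lambda> \<Longrightarrow> \<beta> m = 0" "\<And>a b. w a b = \<beta> a + \<beta> b - \<beta> (a + b)"
proof -
  obtain W where W: "smooth_real_on UNIV (case_prod W)" "\<And>a b. w a b = cls_U1 (W a b)" "cocycle2 W"
    using smooth_cocycle_lift[OF smooth w] by metis
  have Basis\<Lambda>: "i \<in> \<Lambda>" if "i \<in> Basis" for i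
    using that by (auto simp: \<Lambda>_def inner_Basis)
  have "W i a - W a i \<in> \<int>" if "i \<in> Basis" for i a
    using comm[OF Basis\<Lambda>[OF that], of a] by (simp add: W cls_U1_eq_iff)
  then have "W a b = W b a" for a b
    by (rule smooth_real_cocycle_symmetric[OF W(1,3)])
  from smooth_symmetric_cocycle_coboundary[OF W(1,3) this]
  obtain G where G: "smooth_real_on UNIV G" "\<And>a b. W a b = G a + G b - G (a + b)"
    by metis
  \<comment> \<open>The linear function that agrees with \<open>G\<close> on the standard basis, so that \<open>B = G - l\<close> vanishes there.\<close>
  define l where "l a = (\<Sum>i\<in>Basis. (a \<bullet> i) * G i)" for a
  have linl: "bounded_linear l"
    unfolding l_def by (intro bounded_linear_sum bounded_linear_mult_left[THEN bounded_linear_compose]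
        bounded_linear_inner_left)
  define B where "B a = 1 * G a + (-1) * l a" for a
  have smoothB: "smooth_real_on UNIV B"
    unfolding B_def
    by (intro smooth_real_on_lincomb G smooth_real_on_bounded_linear linl open_UNIV)
  have WB: "W a b = B a + B b - B (a + b)" for a b
    using G(2)[of a b] linear_add[OF bounded_linear.linear[OF linl], of a b] by (simp add: B_def)
  have "B m \<in> \<int>" if "m \<in> \<Lambda>" for m
  proof (rule integral_on_lattice_if_additive_mod_1[where B = B])
    fix m m' :: 'a
    assume "\<forall>i\<in>Basis. m \<bullet> i \<in> \<int>" "\<forall>i\<in>Basis. m' \<bullet> i \<in> \<int>"
    then have "W m m' \<in> \<int>"
      using zero[of m m'] by (simp add: \<Lambda>_def W(2) cls_U1_eq_0_iff)
    then have "- W m m' \<in> \<int>"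
      by (rule Ints_minus)
    then show "B (m + m') - B m - B m' \<in> \<int>"
      by (simp add: WB algebra_simps)
  next
    fix i :: 'a assume "i \<in> Basis"
    then have "l i = G i"
      by (simp add: l_def inner_Basis if_distrib[of "\<lambda>x. x * _"] cong: if_cong)
    then show "B i \<in> \<int>"
      by (simp add: B_def)
  qed (use that in \<open>simp add: \<Lambda>_def\<close>)
  then have "cls_U1 (B m) = 0" if "m \<in> \<Lambda>" for m
    using that by (simp add: cls_U1_eq_0_iff)
  moreover have "w a b = cls_U1 (B a) + cls_U1 (B b) - cls_U1 (B (a + b))" for a b
    by (simp add: W(2) WB cls_U1_add cls_U1_diff)
  ultimately show ?thesis
    using smooth_U1_cls[OF smoothB] that by blast
qed

section \<open>The group of integral matrices preserving the form up to sign\<close>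

lemma matrix_mul_minus_left: "(- A) ** B = - (A ** B)"
  and matrix_mul_minus_right: "A ** (- B) = - (A ** B)"
  for A B :: "int ^ 'n::finite ^ 'n"
  by (simp_all add: vec_eq_iff matrix_matrix_mult_def sum_negf)

lemma Opm_form_mult:
  fixes A B :: "'n::finite mat2"
  shows "transpose (A ** B) ** matI ** (A ** B) =
    transpose B ** (transpose A ** matI ** A) ** B"
  by (simp add: matrix_transpose_mul matrix_mul_assoc)

lemma Opm_mult_closed:
  assumes "A \<in> Opm" "B \<in> Opm"
  shows "A ** B \<in> Opm"
proof -
  have "invertible (A ** B)"
    using assms by (simp add: Opm_def invertible_mult)
  then show ?thesis
    using assms unfolding Opm_def
    by (auto simp: Opm_form_mult matrix_mul_minus_left matrix_mul_minus_right)
qed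

lemma iso_sign_mult:
  assumes "A \<in> Opm" "B \<in> Opm"
  shows "iso_sign (A ** B) = iso_sign A * iso_sign B"
proof -
  have "transpose A ** matI ** A = matI \<or> transpose A ** matI ** A = - matI"
    "transpose B ** matI ** B = matI \<or> transpose B ** matI ** B = - matI"
    using assms by (auto simp: Opm_def)
  moreover have "- matI \<noteq> (matI :: 'a mat2)"
    using matI_neq_uminus by metis
  ultimately show ?thesis
    unfolding iso_sign_def Opm_form_mult
    by (elim disjE) (simp_all add: matrix_mul_minus_left matrix_mul_minus_right)
qed

lemma Opm_one: "(mat 1 :: 'n::finite mat2) \<in> Opm"
proof -
  have "invertible (mat 1 :: 'n mat2)"
    unfolding invertible_def by (intro exI[of _ "mat 1"]) simp
  then show ?thesis
    by (simp add: Opm_def)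
qed

lemma iso_sign_one: "iso_sign (mat 1) = 1"
  by (simp add: iso_sign_def)

lemma Opm_inverse:
  assumes "A \<in> Opm"
  obtains B where "B \<in> Opm" "B ** A = mat 1"
proof -
  obtain B where B: "A ** B = mat 1" "B ** A = mat 1"
    using assms unfolding Opm_def invertible_def by blast
  have "transpose B ** (transpose A ** matI ** A) ** B = transpose (A ** B) ** matI ** (A ** B)"
    by (rule Opm_form_mult[symmetric])
  also have "\<dots> = matI"
    by (simp add: B)
  finally have eq: "transpose B ** (transpose A ** matI ** A) ** B = matI" .
  have "transpose A ** matI ** A = matI \<or> transpose A ** matI ** A = - matI"
    using assms by (auto simp: Opm_def)
  then have "transpose B ** matI ** B = matI \<or> transpose B ** matI ** B = - matI"
  proof
    assume "transpose A ** matI ** A = - matI"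
    with eq have "- (transpose B ** matI ** B) = matI"
      by (simp add: matrix_mul_minus_left matrix_mul_minus_right)
    then have "transpose B ** matI ** B = - matI"
      by (metis minus_minus)
    then show ?thesis ..
  qed (use eq in simp)
  moreover have "invertible B"
    using B unfolding invertible_def by blast
  ultimately have "B \<in> Opm"
    by (simp add: Opm_def)
  with B(2) that show ?thesis by blast
qed

lemma group_Opm: "group Opm_group"
  by (rule groupI)
    (auto simp: Opm_group_def Opm_mult_closed Opm_one matrix_mul_assoc elim: Opm_inverse)

section \<open>The action on the lattice and on the bracket\<close>

abbreviation realmat :: "int ^ 'n::finite ^ 'm::finite \<Rightarrow> real ^ 'n ^ 'm" where
  "realmat \<equiv> map_matrix of_int"

lemma realmat_mult: "realmat (A ** B) = realmat A ** realmat B"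
  by (simp add: vec_eq_iff matrix_matrix_mult_def)

lemma realmat_transpose: "realmat (transpose A) = transpose (realmat A)"
  by (simp add: vec_eq_iff transpose_def)

lemma realmat_uminus: "realmat (- A) = - realmat A"
  by (simp add: vec_eq_iff)

lemma realmat_one: "realmat (mat 1) = mat 1"
  by (simp add: vec_eq_iff mat_def)

lemma realmat_matI: "realmat matI = matJ + transpose matJ"
proof -
  have "(matI $ i $ j :: int) = (matJ + transpose matJ) $ i $ j" for i j :: "'a + 'a"
    by (cases i; cases j) (auto simp: matI_def matJ_def transpose_def)
  then show ?thesis
    by (simp add: vec_eq_iff)
qed

lemma act_mult: "act (A ** B) a = act A (act B a)"
  by (simp add: act_def realmat_mult matrix_vector_mul_assoc)

lemma act_one: "act (mat 1) a = a"
  by (simp add: act_def realmat_one)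

lemma bounded_linear_act: "bounded_linear (act A)"
  unfolding act_def[abs_def] by simp

lemma act_add: "act A (a + b) = act A a + act A b"
  by (simp add: act_def matrix_vector_right_distrib)

lemma act_lattice: "m \<in> int_lattice \<Longrightarrow> act A m \<in> int_lattice"
  by (auto simp: int_lattice_def act_def matrix_vector_mult_def intro!: Ints_sum Ints_mult)

lemma int_lattice_eq: "int_lattice = {m. \<forall>i\<in>Basis. m \<bullet> i \<in> \<int>}"
  by (force simp: int_lattice_def Basis_vec_def inner_axis)

lemma inner_matrix_vector: "x \<bullet> (A *v y) = (transpose A *v x) \<bullet> y" for A :: "real ^ 'n ^ 'm"
  by (simp add: transpose_matrix_vector dot_lmul_matrix)

lemma Opm_realmat_form:
  assumes "A \<in> Opm"
  shows "transpose (realmat A) ** (matJ + transpose matJ) ** realmat A =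
    of_int (iso_sign A) *\<^sub>R (matJ + transpose matJ)"
proof -
  have "transpose (realmat A) ** (matJ + transpose matJ) ** realmat A =
      realmat (transpose A ** matI ** A)"
    by (simp add: realmat_mult realmat_transpose realmat_matI)
  also have "\<dots> = of_int (iso_sign A) *\<^sub>R realmat matI"
    using assms by (auto simp: Opm_def iso_sign_def realmat_uminus)
  finally show ?thesis
    by (simp add: realmat_matI)
qed

section \<open>Objects over every matrix\<close>

text \<open>The index type carries no order, so an injection into the natural numbers decides which entries
form the strictly lower triangle. The diagonal of \<open>C\<close> vanishes by antisymmetry.\<close>

lemma antisymmetric_matrix_splits:
  fixes C :: "real ^ 'm::finite ^ 'm"
  assumes "transpose C = - C"
  obtains X where "X - transpose X = C" "\<And>i j. X $ i $ j = 0 \<or> X $ i $ j = C $ i $ j"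
proof -
  obtain f :: "'m \<Rightarrow> nat" where f: "inj f"
    using finite_imp_inj_to_nat_seg[of "UNIV :: 'm set"] by auto
  define X where "X = (\<chi> i j. if f j < f i then C $ i $ j else 0)"
  have C: "C $ j $ i = - C $ i $ j" for i j
    using arg_cong[OF assms, of "\<lambda>M. M $ i $ j"] by (simp add: transpose_def)
  have "(X - transpose X) $ i $ j = C $ i $ j" for i j
  proof (cases "f i" "f j" rule: linorder_cases)
    case equal
    then have "i = j" using f by (simp add: inj_eq)
    then show ?thesis using C[of i i] by (simp add: X_def transpose_def)
  qed (use C[of i j] in \<open>simp_all add: X_def transpose_def\<close>)
  then have "X - transpose X = C"
    by (simp add: vec_eq_iff)
  moreover have "X $ i $ j = 0 \<or> X $ i $ j = C $ i $ j" for i j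
    by (simp add: X_def)
  ultimately show ?thesis by (rule that)
qed

text \<open>With \<open>\<eta>(a, b) = a \<bullet> X b\<close> mod 1, the commutation condition holds already before reduction
modulo 1, because \<open>X - X\<^sup>t = iso(A) J - A\<^sup>t J A\<close>.\<close>

lemma Objs_exists:
  assumes A: "A \<in> Opm"
  obtains \<eta> where "(A, \<eta>) \<in> Objs"
proof -
  let ?R = "realmat A" and ?e = "real_of_int (iso_sign A)"
  define C where "C = ?e *\<^sub>R matJ - transpose ?R ** matJ ** ?R"
  have tC: "transpose C = ?e *\<^sub>R transpose matJ - transpose ?R ** transpose matJ ** ?R"
  proof -
    have "transpose C = ?e *\<^sub>R transpose matJ - transpose (transpose ?R ** matJ ** ?R)"
      by (simp add: C_def vec_eq_iff transpose_def)
    then show ?thesis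
      by (simp add: matrix_transpose_mul matrix_mul_assoc)
  qed
  have rdistrib: "(M + N) ** ?R = M ** ?R + N ** ?R" for M N
    by (simp add: vec_eq_iff matrix_matrix_mult_def sum.distrib distrib_right)
  have "C + transpose C = ?e *\<^sub>R (matJ + transpose matJ) -
      transpose ?R ** (matJ + transpose matJ) ** ?R"
    unfolding tC unfolding C_def by (simp add: matrix_add_ldistrib rdistrib scaleR_right_distrib)
  also have "\<dots> = 0"
    by (simp add: Opm_realmat_form[OF A])
  finally have "transpose C = - C"
    by (simp add: add_eq_0_iff)
  then obtain X where X: "X - transpose X = C" "\<And>i j. X $ i $ j = 0 \<or> X $ i $ j = C $ i $ j"
    by (rule antisymmetric_matrix_splits) blast
  have JZ: "matJ $ i $ j \<in> \<int>" for i j :: "'a + 'a"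
    by (cases i; cases j) (auto simp: matJ_def)
  have "C $ i $ j \<in> \<int>" for i j
    by (auto simp: C_def matrix_matrix_mult_def transpose_def
        intro!: Ints_diff Ints_mult Ints_sum JZ)
  then have XZ: "X $ i $ j \<in> \<int>" for i j
    using X(2)[of i j] by auto
  define \<eta> where "\<eta> a b = cls_U1 (a \<bullet> (X *v b))" for a b
  have "bounded_bilinear (\<lambda>a b. a \<bullet> (X *v b))"
    by (rule bounded_bilinear.comp[OF bounded_bilinear_inner bounded_linear_ident]) simp
  from smooth_U1_cls[OF smooth_real_on_bounded_bilinear[OF this]]
  have "smooth_U1 (case_prod \<eta>)"
    by (simp add: \<eta>_def case_prod_beta')
  moreover have "\<eta> m m' = 0" if "m \<in> int_lattice" "m' \<in> int_lattice" for m m'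
    using that unfolding \<eta>_def cls_U1_eq_0_iff
    by (auto simp: int_lattice_def inner_vec_def matrix_vector_mult_def intro!: Ints_sum Ints_mult XZ)
  moreover have "\<eta> m a + iso_sign A \<bullet>\<^sub>\<int> cls_U1 (bracket a m) =
      \<eta> a m + cls_U1 (bracket (act A a) (act A m))" for a m
  proof -
    have "m \<bullet> (X *v a) = a \<bullet> (transpose X *v m)"
      by (simp add: inner_matrix_vector inner_commute)
    moreover have "bracket (act A a) (act A m) = a \<bullet> ((transpose ?R ** matJ ** ?R) *v m)"
      by (simp add: bracket_def act_def inner_matrix_vector matrix_vector_mul_assoc
          matrix_transpose_mul matrix_mul_assoc)
    moreover have "?e * bracket a m = a \<bullet> ((?e *\<^sub>R matJ) *v m)"
      by (simp add: bracket_def flip: scaleR_matrix_vector_assoc)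
    moreover have "a \<bullet> (X *v m) = a \<bullet> (transpose X *v m) + a \<bullet> (C *v m)"
      by (simp add: matrix_vector_mult_diff_rdistrib inner_diff_right flip: X(1))
    ultimately have "m \<bullet> (X *v a) + ?e * bracket a m = a \<bullet> (X *v m) + bracket (act A a) (act A m)"
      by (simp add: C_def matrix_vector_mult_diff_rdistrib inner_diff_right)
    then show ?thesis
      unfolding \<eta>_def int_mult_cls_U1 cls_U1_add[symmetric] by simp
  qed
  moreover have "\<eta> a a' + \<eta> (a + a') a'' = \<eta> a' a'' + \<eta> a (a' + a'')" for a a' a''
    unfolding \<eta>_def cls_U1_add[symmetric]
    by (simp add: inner_add_left inner_add_right matrix_vector_right_distrib algebra_simps)
  ultimately have "(A, \<eta>) \<in> Objs"
    using A by (simp add: Objs_def)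
  then show ?thesis by (rule that)
qed

section \<open>Isomorphism classes\<close>

lemma obj_one_Objs: "(obj_one :: 'a::finite obj) \<in> Objs"
proof -
  have "smooth_U1 (\<lambda>(_ :: 'a vec2, _ :: 'a vec2). 0)"
    using smooth_U1_zero by (simp add: case_prod_beta')
  then show ?thesis
    by (simp add: obj_one_def Objs_def Opm_one iso_sign_one act_one)
qed

text \<open>Only the commutation condition needs an idea: it is obtained by applying the condition for \<open>\<xi>\<close> to
\<open>(a, m)\<close> and then the one for \<open>\<eta>\<close> to \<open>(B a, B m)\<close>, where \<open>B m\<close> is again a lattice point. The bracket
terms in between cancel.\<close>

lemma obj_mult_closed:
  assumes "x \<in> Objs" "y \<in> Objs"
  shows "obj_mult x y \<in> Objs"
proof -
  obtain A \<eta> B \<xi> where x: "x = (A, \<eta>)" and y: "y = (B, \<xi>)"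
    by (cases x; cases y)
  have A: "A \<in> Opm" "smooth_U1 (case_prod \<eta>)"
      "\<And>m m'. m \<in> int_lattice \<Longrightarrow> m' \<in> int_lattice \<Longrightarrow> \<eta> m m' = 0"
      "\<And>a m. m \<in> int_lattice \<Longrightarrow> \<eta> m a + iso_sign A \<bullet>\<^sub>\<int> cls_U1 (bracket a m) =
        \<eta> a m + cls_U1 (bracket (act A a) (act A m))"
      "\<And>a a' a''. \<eta> a a' + \<eta> (a + a') a'' = \<eta> a' a'' + \<eta> a (a' + a'')"
    using assms(1) by (simp_all add: x Objs_def)
  have B: "B \<in> Opm" "smooth_U1 (case_prod \<xi>)"
      "\<And>m m'. m \<in> int_lattice \<Longrightarrow> m' \<in> int_lattice \<Longrightarrow> \<xi> m m' = 0"
      "\<And>a m. m \<in> int_lattice \<Longrightarrow> \<xi> m a + iso_sign B \<bullet>\<^sub>\<int> cls_U1 (bracket a m) =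
        \<xi> a m + cls_U1 (bracket (act B a) (act B m))"
      "\<And>a a' a''. \<xi> a a' + \<xi> (a + a') a'' = \<xi> a' a'' + \<xi> a (a' + a'')"
    using assms(2) by (simp_all add: y Objs_def)
  define \<zeta> where "\<zeta> a a' = \<eta> (act B a) (act B a') + iso_sign A \<bullet>\<^sub>\<int> \<xi> a a'" for a a'
  have "bounded_linear (\<lambda>p. (act B (fst p), act B (snd p)))"
    by (intro bounded_linear_Pair bounded_linear_compose[OF bounded_linear_act]
        bounded_linear_fst bounded_linear_snd)
  from smooth_U1_lincomb[OF smooth_U1_compose_linear[OF A(2) this] B(2), of 1 "iso_sign A"]
  have "smooth_U1 (case_prod \<zeta>)"
    by (simp add: \<zeta>_def case_prod_beta')
  moreover have "\<zeta> m m' = 0" if "m \<in> int_lattice" "m' \<in> int_lattice" for m m'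
    using that by (simp add: \<zeta>_def A(3) B(3) act_lattice)
  moreover have "\<zeta> m a + iso_sign (A ** B) \<bullet>\<^sub>\<int> cls_U1 (bracket a m) =
      \<zeta> a m + cls_U1 (bracket (act (A ** B) a) (act (A ** B) m))" if m: "m \<in> int_lattice" for a m
  proof -
    have "\<zeta> m a + iso_sign (A ** B) \<bullet>\<^sub>\<int> cls_U1 (bracket a m) =
        \<eta> (act B m) (act B a) + iso_sign A \<bullet>\<^sub>\<int> (\<xi> m a + iso_sign B \<bullet>\<^sub>\<int> cls_U1 (bracket a m))"
      by (simp add: \<zeta>_def iso_sign_mult A(1) B(1) int_mult_U1_mult int_mult_U1_add add.assoc)
    also have "\<dots> = (\<eta> (act B m) (act B a) + iso_sign A \<bullet>\<^sub>\<int> cls_U1 (bracket (act B a) (act B m))) +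
        iso_sign A \<bullet>\<^sub>\<int> \<xi> a m"
      by (simp add: B(4)[OF m] int_mult_U1_add algebra_simps)
    also have "\<dots> = \<zeta> a m + cls_U1 (bracket (act (A ** B) a) (act (A ** B) m))"
      by (simp add: A(4) act_lattice[OF m] \<zeta>_def act_mult algebra_simps)
    finally show ?thesis .
  qed
  moreover have "\<zeta> a a' + \<zeta> (a + a') a'' = \<zeta> a' a'' + \<zeta> a (a' + a'')" for a a' a''
  proof -
    have "\<zeta> a a' + \<zeta> (a + a') a'' =
        (\<eta> (act B a) (act B a') + \<eta> (act B a + act B a') (act B a'')) +
        iso_sign A \<bullet>\<^sub>\<int> (\<xi> a a' + \<xi> (a + a') a'')"
      by (simp add: \<zeta>_def act_add int_mult_U1_add algebra_simps)
    also have "\<dots> = \<zeta> a' a'' + \<zeta> a (a' + a'')"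
      unfolding A(5) B(5) by (simp add: \<zeta>_def act_add int_mult_U1_add algebra_simps)
    finally show ?thesis .
  qed
  moreover have "obj_mult x y = (A ** B, \<zeta>)"
    by (simp add: x y obj_mult_def \<zeta>_def[abs_def])
  ultimately show ?thesis
    using Opm_mult_closed[OF A(1) B(1)] by (simp add: Objs_def)
qed

text \<open>The bracket terms in the commutation condition depend only on \<open>A\<close>, so they cancel in the
difference of the two cocycles, which is therefore symmetric against lattice points. A function with this
difference as its coboundary is a morphism, and its negative is the inverse.\<close>

lemma iso_rel_same_matrix:
  assumes x: "(A, \<eta>) \<in> Objs" and y: "(A, \<eta>') \<in> Objs"
  shows "((A, \<eta>), (A, \<eta>')) \<in> iso_rel"
proof -
  define w where "w a b = \<eta>' a b - \<eta> a b" for a b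
  have sx: "smooth_U1 (case_prod \<eta>)" and sy: "smooth_U1 (case_prod \<eta>')"
    using x y by (simp_all add: Objs_def)
  have "smooth_U1 (\<lambda>p. 1 \<bullet>\<^sub>\<int> case_prod \<eta>' p + (- 1) \<bullet>\<^sub>\<int> case_prod \<eta> p)"
    by (rule smooth_U1_lincomb[OF sy sx])
  then have smooth: "smooth_U1 (case_prod w)"
    by (simp add: w_def int_mult_U1_minus_1 case_prod_beta')
  have cocycle: "cocycle2 w"
  proof -
    have "\<eta> a b + \<eta> (a + b) c = \<eta> b c + \<eta> a (b + c)" "\<eta>' a b + \<eta>' (a + b) c = \<eta>' b c + \<eta>' a (b + c)"
      for a b c
      using x y by (simp_all add: Objs_def)
    then show ?thesis
      unfolding cocycle2_def w_def by (metis add_diff_add)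
  qed
  have zero: "w m m' = 0" if "m \<in> int_lattice" "m' \<in> int_lattice" for m m'
    using x y that by (simp add: Objs_def w_def)
  have comm: "w m a = w a m" if "m \<in> int_lattice" for m a
  proof -
    let ?p = "iso_sign A \<bullet>\<^sub>\<int> cls_U1 (bracket a m)" and ?q = "cls_U1 (bracket (act A a) (act A m))"
    have "\<eta> m a + ?p = \<eta> a m + ?q" "\<eta>' m a + ?p = \<eta>' a m + ?q"
      using x y that by (simp_all add: Objs_def)
    then have "(\<eta>' m a + ?p) - (\<eta> m a + ?p) = (\<eta>' a m + ?q) - (\<eta> a m + ?q)"
      by simp
    then show ?thesis
      by (simp add: w_def)
  qed
  obtain \<beta> where \<beta>: "smooth_U1 \<beta>" "\<And>m. m \<in> int_lattice \<Longrightarrow> \<beta> m = 0"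
    "\<And>a b. w a b = \<beta> a + \<beta> b - \<beta> (a + b)"
    using smooth_U1_cocycle_trivial[of w, folded int_lattice_eq, OF smooth cocycle zero comm] by blast
  have eq: "\<eta>' a b - \<eta> a b = \<beta> a + \<beta> b - \<beta> (a + b)" for a b
    using \<beta>(3) by (simp add: w_def)
  have "smooth_U1 (\<lambda>a. (- 1) \<bullet>\<^sub>\<int> \<beta> a + 0 \<bullet>\<^sub>\<int> \<beta> a)"
    by (rule smooth_U1_lincomb[OF \<beta>(1) \<beta>(1)])
  moreover have "0 \<bullet>\<^sub>\<int> u = 0" for u
    by transfer simp
  ultimately have smooth_neg: "smooth_U1 (\<lambda>a. - \<beta> a)"
    by (simp add: int_mult_U1_minus_1)
  have "\<beta> \<in> Homs (A, \<eta>) (A, \<eta>')"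
    using \<beta>(1,2) eq by (simp add: Homs_def) (simp add: algebra_simps)
  moreover have "(\<lambda>a. - \<beta> a) \<in> Homs (A, \<eta>') (A, \<eta>)"
    using smooth_neg \<beta>(2) eq by (simp add: Homs_def) (simp add: algebra_simps)
  moreover have "hom_comp (\<lambda>a. - \<beta> a) \<beta> = hom_id" "hom_comp \<beta> (\<lambda>a. - \<beta> a) = hom_id"
    by (simp_all add: hom_comp_def hom_id_def)
  ultimately show ?thesis
    using x y unfolding iso_rel_def by blast
qed

definition obj_class :: "'n::finite mat2 \<Rightarrow> 'n obj set" where
  "obj_class A = {x \<in> Objs. fst x = A}"

lemma iso_rel_class:
  assumes "x \<in> Objs"
  shows "iso_rel `` {x} = obj_class (fst x)"
proof (intro equalityI subsetI)
  fix y assume "y \<in> iso_rel `` {x}"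
  then have "y \<in> Objs" "Homs x y \<noteq> {}"
    by (auto simp: iso_rel_def)
  then show "y \<in> obj_class (fst x)"
    by (auto simp: Homs_def obj_class_def split: prod.splits)
next
  fix y assume "y \<in> obj_class (fst x)"
  then show "y \<in> iso_rel `` {x}"
    using iso_rel_same_matrix assms by (cases x; cases y) (auto simp: obj_class_def)
qed

lemma obj_class_nonempty:
  assumes "A \<in> Opm"
  obtains x where "x \<in> obj_class A"
proof -
  obtain \<eta> where "(A, \<eta>) \<in> Objs"
    using assms by (rule Objs_exists)
  then have "(A, \<eta>) \<in> obj_class A"
    by (simp add: obj_class_def)
  then show ?thesis by (rule that)
qed

lemma fst_Objs: "x \<in> Objs \<Longrightarrow> fst x \<in> Opm"
  by (auto simp: Objs_def)

lemma projP_obj_class: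
  assumes "A \<in> Opm"
  shows "projP (obj_class A) = A"
proof -
  obtain x where "x \<in> obj_class A"
    using assms by (rule obj_class_nonempty)
  then have "fst ` obj_class A = {A}"
    by (force simp: obj_class_def)
  then show ?thesis
    by (simp add: projP_def)
qed

lemma carrier_pi0: "carrier pi0 = obj_class ` (Opm :: 'n::finite mat2 set)"
proof -
  have "carrier pi0 = obj_class ` fst ` Objs"
    by (auto simp: pi0_def quotient_def iso_rel_class image_image)
  also have "fst ` Objs = (Opm :: 'n mat2 set)"
  proof (intro equalityI subsetI)
    fix A :: "'n mat2" assume "A \<in> Opm"
    then obtain \<eta> where "(A, \<eta>) \<in> Objs" by (rule Objs_exists)
    then show "A \<in> fst ` Objs" by force
  qed (use fst_Objs in blast)
  finally show ?thesis .
qed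

lemma one_pi0: "one pi0 = obj_class (mat 1 :: 'n::finite mat2)"
  using iso_rel_class[OF obj_one_Objs] by (simp add: pi0_def obj_one_def)

lemma mult_pi0:
  assumes "A \<in> Opm" "B \<in> Opm"
  shows "obj_class A \<otimes>\<^bsub>pi0\<^esub> obj_class B = obj_class (A ** B)"
proof -
  have "iso_rel `` {obj_mult x y} = obj_class (A ** B)"
    if "x \<in> obj_class A" "y \<in> obj_class B" for x y
    using that iso_rel_class[OF obj_mult_closed[of x y]]
    by (auto simp: obj_class_def obj_mult_def split: prod.splits)
  moreover obtain x where "x \<in> obj_class A"
    using assms(1) by (rule obj_class_nonempty)
  moreover obtain y where "y \<in> obj_class B"
    using assms(2) by (rule obj_class_nonempty)
  ultimately show ?thesis
    by (auto simp: pi0_def)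
qed

lemma obj_class_hom: "obj_class \<in> hom Opm_group pi0"
  by (auto simp: hom_def carrier_pi0 mult_pi0 Opm_group_def)

text \<open>Since \<open>obj_class\<close> preserves products and maps onto the carrier, \<open>\<pi>\<^sub>0\<close> is the homomorphic image of a
group.\<close>

lemma group_pi0: "group (pi0 :: 'n::finite obj set monoid)"
proof -
  have "group ((pi0 :: 'n obj set monoid) \<lparr>carrier := obj_class ` carrier Opm_group, one := obj_class \<one>\<^bsub>Opm_group\<^esub>\<rparr>)"
    by (rule group.hom_imp_img_group[OF group_Opm obj_class_hom])
  moreover have "(pi0 :: 'n obj set monoid) \<lparr>carrier := obj_class ` carrier Opm_group, one := obj_class \<one>\<^bsub>Opm_group\<^esub>\<rparr> = pi0"
    using carrier_pi0[where 'n = 'n] one_pi0[where 'n = 'n] by (simp add: Opm_group_def pi0_def)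
  ultimately show ?thesis by simp
qed

lemma projP_iso: "projP \<in> iso pi0 Opm_group"
proof (rule isoI)
  show "projP \<in> hom pi0 Opm_group"
    by (rule homI)
      (auto simp: carrier_pi0 mult_pi0 projP_obj_class Opm_mult_closed Opm_group_def)
  show "bij_betw projP (carrier pi0) (carrier Opm_group)"
    by (rule bij_betw_byWitness[where f' = obj_class])
      (auto simp: carrier_pi0 projP_obj_class Opm_group_def)
qed

theorem proposition5p2p2:
  shows "group (pi0 :: ('n::finite obj set) monoid) \<and>
         group (Opm_group :: 'n mat2 monoid) \<and>
         projP \<in> iso (pi0 :: ('n obj set) monoid) (Opm_group :: 'n mat2 monoid)"
  using group_pi0 group_Opm projP_iso by blast

end
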